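(* Let $x_0\sim\mathrm{GMM}(\alpha_i,\mu_0^i,\Sigma_0^i)_{i=1:K}$ be a random vector in $\mathbb{R}^{n_x}$ with each $\Sigma_0^i\succ0$. Let $v_k\in\mathbb{R}^{n_u}$ and $L_k^i\in\mathbb{R}^{n_u\times n_x}$ ($k=0,\dots,N-1$, $i=1,\dots,K$) be arbitrary, and let the control inputs $u_0,\dots,u_{N-1}$ be generated by the randomized affine policy described in the context. Then for every $k=0,\dots,N-1$, $u_k\sim\mathrm{GMM}(\alpha_i,\mu_{u,k}^i,\Sigma_{u,k}^i)_{i=1:K}$, where $$\mu_{u,k}^i=v_k+L_k^i(\mu_0^i-\mu_0^g),\qquad \Sigma_{u,k}^i=L_k^i\Sigma_0^i(L_k^i)^\top .$$
   Context: Gaussian mixtures: for weights $\alpha_i\ge0$ with $\sum_{i=1}^K\alpha_i=1$, $x\sim\mathrm{GMM}(\alpha_i,\mu_i,\Sigma_i)_{i=1:K}$ means that the law of $x$ is $\sum_{i=1}^K\alpha_i\,\mathcal N(\mu_i,\Sigma_i)$, where $\mathcal N(\mu,\Sigma)$ is the (possibly degenerate, $\Sigma\succeq0$) Gaussian law. $f_{\mathcal N}(\cdot;\mu,\Sigma)$ is the Gaussian density for $\Sigma\succ0$. Policy: let $\mu_0^g=\mathbb{E}[x_0]=\sum_{i=1}^K\alpha_i\mu_0^i$ and $$\lambda_i(x)=\frac{\alpha_i f_{\mathcal N}(x;\mu_0^i,\Sigma_0^i)}{\sum_{j=1}^K\alpha_jf_{\mathcal N}(x;\mu_0^j,\Sigma_0^j)}.$$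 After $x_0$ is observed, a single random index $I\in\{1,\dots,K\}$ is drawn with $\mathbb{P}[I=i\mid x_0]=\lambda_i(x_0)$, and the control is $u_k=v_k+L_k^{I}(x_0-\mu_0^g)$ for all $k=0,\dots,N-1$ (the same index $I$ is used at all times). *)

theory Defs
  imports "HOL-Probability.Probability"
begin

definition pos_def :: "real^'n^'n \<Rightarrow> bool" where
  "pos_def S \<longleftrightarrow> transpose S = S \<and> (\<forall>x. x \<noteq> 0 \<longrightarrow> x \<bullet> (S *v x) > 0)"

definition mvn_density :: "real^'n \<Rightarrow> real^'n \<Rightarrow> real^'n^'n \<Rightarrow> real" where
  "mvn_density x \<mu> S =
     exp (- ((x - \<mu>) \<bullet> (matrix_inv S *v (x - \<mu>))) / 2) / sqrt ((2 * pi) ^ CARD('n) * det S)"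

(* The Gaussian law is given by its characteristic function, so that singular covariance
   matrices (for which there is no density) are covered. *)
definition is_mvn :: "(real^'n) measure \<Rightarrow> real^'n \<Rightarrow> real^'n^'n \<Rightarrow> bool" where
  "is_mvn M \<mu> S \<longleftrightarrow>
     prob_space M \<and> sets M = sets borel \<and>
     (\<forall>t. (CLINT x|M. iexp (t \<bullet> x)) =
        exp (\<i> * complex_of_real (t \<bullet> \<mu>) - complex_of_real (t \<bullet> (S *v t)) / 2))"

(* Exactly one such measure exists for every symmetric positive semidefinite S;
   the value is unspecified for other matrices. *)
definition mvn :: "real^'n \<Rightarrow> real^'n^'n \<Rightarrow> (real^'n) measure" where
  "mvn \<mu> S = (THE M. is_mvn M \<mu> S)"

definition has_gmm_law ::
  "'w measure \<Rightarrow> ('w \<Rightarrow> real^'n) \<Rightarrow> nat \<Rightarrow> (nat \<Rightarrow> real) \<Rightarrow> (nat \<Rightarrow> real^'n) \<Rightarrow> (nat \<Rightarrow> real^'n^'n) \<Rightarrow> bool"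
where
  "has_gmm_law P X K \<alpha> \<mu> S \<longleftrightarrow>
     X \<in> borel_measurable P \<and>
     (\<forall>B\<in>sets borel. measure (distr P borel X) B = (\<Sum>i=1..K. \<alpha> i * measure (mvn (\<mu> i) (S i)) B))"

definition gmm_posterior ::
  "nat \<Rightarrow> (nat \<Rightarrow> real) \<Rightarrow> (nat \<Rightarrow> real^'n) \<Rightarrow> (nat \<Rightarrow> real^'n^'n) \<Rightarrow> nat \<Rightarrow> real^'n \<Rightarrow> real"
where
  "gmm_posterior K \<alpha> \<mu> S i x =
     \<alpha> i * mvn_density x (\<mu> i) (S i) / (\<Sum>j=1..K. \<alpha> j * mvn_density x (\<mu> j) (S j))"

(* Conditional probability given X, i.e. given the sigma-algebra generated by X. *)
definition cond_prob_given :: "'w measure \<Rightarrow> ('w \<Rightarrow> real^'n) \<Rightarrow> 'w set \<Rightarrow> 'w \<Rightarrow> real" where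
  "cond_prob_given P X A = real_cond_exp P (vimage_algebra (space P) X borel) (indicator A)"

end

(* Bayes' rule makes the posterior weights cancel the mixture density: on the event that the drawn
   index is i, the law of the initial state is the i-th component scaled by its weight. On that event
   the control is an affine image of the state, and affine images of Gaussian laws are Gaussian, as
   their characteristic functions show. Since Gaussian laws are defined here through characteristic
   functions, this needs uniqueness in several dimensions, which is reduced to Levy's theorem on the
   line one coordinate at a time, and the fact that the density of a nondegenerate Gaussian has the
   right characteristic function, which follows from a factorization S = A A^T and the linear change
   of variables x = A z. *)

theory Submission
  imports Defs
begin

section \<open>Uniqueness of finite measures with equal characteristic functions\<close>

lemma integrable_iexp_inner:
  fixes M :: "'a::euclidean_space measure"
  assumes "finite_measure M" "sets M = sets borel"
  shows "integrable M (\<lambda>x. iexp (t \<bullet> x))"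
proof -
  interpret finite_measure M by fact
  note [measurable_cong] = assms(2)
  show ?thesis
    by (rule integrable_const_bound[where B=1]) auto
qed

text \<open>Levy's theorem concerns probability measures. The value at frequency 0 is the total
  mass, so both measures have the same mass and can be divided by it; mass 0 is treated
  separately.\<close>

lemma finite_measure_real_eqI_cf:
  fixes M N :: "real measure"
  assumes M: "finite_measure M" "sets M = sets borel"
    and N: "finite_measure N" "sets N = sets borel"
    and cf: "\<And>t. (CLINT x|M. iexp (t * x)) = (CLINT x|N. iexp (t * x))"
  shows "M = N"
proof -
  interpret M: finite_measure M by fact
  interpret N: finite_measure N by fact
  note [measurable_cong] = M(2) N(2)
  have sp: "space M = UNIV" "space N = UNIV"
    using sets_eq_imp_space_eq[OF M(2)] sets_eq_imp_space_eq[OF N(2)] by auto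
  define c where "c = measure M UNIV"
  have cN: "c = measure N UNIV"
    using cf[of 0] sp by (simp add: c_def)
  have emM: "emeasure M UNIV = ennreal c" and emN: "emeasure N UNIV = ennreal c"
    by (simp_all add: c_def M.emeasure_eq_measure N.emeasure_eq_measure flip: cN)
  have c0: "c \<ge> 0" by (simp add: c_def)
  show ?thesis
  proof (cases "c = 0")
    case True
    \<comment> \<open>With total mass 0, every set has measure 0 under both measures, by
      monotonicity or because it is not measurable.\<close>
    have "emeasure M A = emeasure N A" for A
      using emeasure_mono[of A UNIV M] emeasure_mono[of A UNIV N] emM emN M(2) N(2) True
      by (metis emeasure_notin_sets ennreal_0 le_zero_eq sp(1,2) subset_UNIV sets.top)
    then show ?thesis using M N by (intro measure_eqI) auto
  next
    case False
    let ?M = "density M (\<lambda>_. ennreal (1/c))" and ?N = "density N (\<lambda>_. ennreal (1/c))"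
    have c: "c > 0" using c0 False by auto
    have one: "ennreal (1/c) * ennreal c = 1"
      using c by (simp flip: ennreal_mult)
    have "real_distribution ?M" "real_distribution ?N"
      using c sp M(2) N(2) emM emN one
      by (auto simp: real_distribution_def real_distribution_axioms_def emeasure_density
          nn_integral_cmult  intro!: prob_spaceI)
    moreover have "char ?M = char ?N"
      using cf c by (auto simp: char_def integral_density fun_eq_iff)
    ultimately have eq: "?M = ?N" by (rule Levy_uniqueness)
    have "emeasure M A = emeasure N A" if "A \<in> sets borel" for A
    proof -
      have "ennreal (1/c) * emeasure M A = ennreal (1/c) * emeasure N A"
        using arg_cong[OF eq, of "\<lambda>D. emeasure D A"] that M N
        by (simp add: emeasure_density nn_integral_cmult_indicator)
      then show ?thesis using c by (simp add: ennreal_mult_cancel_left)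
    qed
    then show ?thesis using M N by (intro measure_eqI) auto
  qed
qed

text \<open>A nonnegative bounded weight keeps the measure finite and positive, so the
  one-dimensional uniqueness result applies to the projection of the weighted measure to the
  direction \<open>b\<close>.\<close>

lemma weighted_marginal_eqI:
  fixes M N :: "'a::euclidean_space measure"
  assumes M: "finite_measure M" "sets M = sets borel"
    and N: "finite_measure N" "sets N = sets borel"
    and w[measurable]: "w \<in> borel_measurable borel" and w0: "\<And>x. 0 \<le> w x" and wC: "\<And>x. w x \<le> C"
    and cf: "\<And>s. (CLINT x|M. w x *\<^sub>R iexp (s * (x \<bullet> b))) = (CLINT x|N. w x *\<^sub>R iexp (s * (x \<bullet> b)))"
    and B[measurable]: "B \<in> sets borel"
  shows "(LINT x|M. w x * indicator B (x \<bullet> b)) = (LINT x|N. w x * indicator B (x \<bullet> b))"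
proof -
  \<comment> \<open>The characteristic function of \<open>?D M\<close> at \<open>s\<close> is
    exactly the integral in the hypothesis \<open>cf\<close>.\<close>
  let ?D = "\<lambda>M. distr (density M (\<lambda>x. ennreal (w x))) borel (\<lambda>x. x \<bullet> b)"
  have fin: "finite_measure (?D M)" if "finite_measure M" "sets M = sets borel" for M :: "'a measure"
  proof -
    interpret finite_measure M by fact
    note [measurable_cong] = that(2)
    have "integrable M w"
      using w0 wC by (intro integrable_const_bound[where B=C]) auto
    then have "(\<integral>\<^sup>+x. ennreal (w x) \<partial>M) < \<infinity>"
      using w0 by (simp add: nn_integral_eq_integral)
    then have "finite_measure (density M (\<lambda>x. ennreal (w x)))"
      by (intro finite_measureI) (auto simp: emeasure_density cong: nn_integral_cong_simp)
    then show ?thesis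
      by (rule finite_measure.finite_measure_distr) simp
  qed
  have int: "integral\<^sup>L (?D M) f = (LINT x|M. w x *\<^sub>R f (x \<bullet> b))"
    if "sets M = sets borel" "f \<in> borel_measurable borel"
    for M :: "'a measure" and f :: "real \<Rightarrow> 'b::{banach, second_countable_topology}"
  proof -
    note [measurable_cong] = that(1)
    note [measurable] = that(2)
    show ?thesis using w0 by (simp add: integral_distr integral_density)
  qed
  have "?D M = ?D N"
    using cf by (intro finite_measure_real_eqI_cf fin M N) (simp_all add: int M N)
  then have "integral\<^sup>L (?D M) (indicator B :: real \<Rightarrow> real) = integral\<^sup>L (?D N) (indicator B)" by simp
  then show ?thesis
    using int[of M "indicator B :: real \<Rightarrow> real"] int[of N "indicator B :: real \<Rightarrow> real"] M N by simp
qed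

text \<open>The one-dimensional theorem applies only to positive measures, so the oscillating factor is
  replaced by the nonnegative weights \<open>1 + cos (t \<bullet> x)\<close> and \<open>1 + sin (t \<bullet> x)\<close>. Each of them is a
  combination of characters, hence the weighted measures have marginals with equal characteristic
  functions.\<close>

lemma cf_indicator_slab:
  fixes M N :: "'a::euclidean_space measure"
  assumes M: "finite_measure M" "sets M = sets borel"
    and N: "finite_measure N" "sets N = sets borel"
    and cf: "\<And>t. (CLINT x|M. iexp (t \<bullet> x)) = (CLINT x|N. iexp (t \<bullet> x))"
    and B[measurable]: "B \<in> sets borel"
  shows "(CLINT x|M. indicator B (x \<bullet> b) *\<^sub>R iexp (t \<bullet> x)) = (CLINT x|N. indicator B (x \<bullet> b) *\<^sub>R iexp (t \<bullet> x))"
proof -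
  define wc where "wc = (\<lambda>x. 1 + cos (t \<bullet> x))"
  define ws where "ws = (\<lambda>x. 1 + sin (t \<bullet> x))"
  have meas[measurable]: "wc \<in> borel_measurable borel" "ws \<in> borel_measurable borel"
    by (simp_all add: wc_def ws_def)
  have wc: "0 \<le> wc x" "wc x \<le> 2" and ws: "0 \<le> ws x" "ws x \<le> 2" for x
    using cos_ge_minus_one[of "t \<bullet> x"] sin_ge_minus_one[of "t \<bullet> x"]
    using cos_le_one[of "t \<bullet> x"] sin_le_one[of "t \<bullet> x"]
    unfolding wc_def ws_def by linarith+
  let ?E = "\<lambda>u (x::'a). iexp (u \<bullet> x)"
  have 1: "(LINT x|M. 1 * indicator B (x \<bullet> b)) = (LINT x|N. 1 * indicator B (x \<bullet> b) :: real)"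
  proof (rule weighted_marginal_eqI[OF M N, where C=1])
    show "(CLINT x|M. 1 *\<^sub>R iexp (s * (x \<bullet> b))) = (CLINT x|N. 1 *\<^sub>R iexp (s * (x \<bullet> b)))" for s
      using cf[of "s *\<^sub>R b"] by (simp add: inner_commute)
  qed (simp_all add: B)
  \<comment> \<open>Euler's formula writes the cosine as half the sum of the characters of
    frequencies \<open>t\<close> and \<open>-t\<close>; multiplying by the character of
    \<open>s *\<^sub>R b\<close> shifts these frequencies. The sine below is treated alike, with
    factors \<open>-\<i>/2\<close> and \<open>\<i>/2\<close>.\<close>
  have C: "(CLINT x|M. wc x *\<^sub>R iexp (s * (x \<bullet> b))) =
      (CLINT x|M. ?E (s *\<^sub>R b) x) + (CLINT x|M. ?E (s *\<^sub>R b + t) x) / 2 + (CLINT x|M. ?E (s *\<^sub>R b - t) x) / 2"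
    if M: "finite_measure M" "sets M = sets borel" for M and s
  proof -
    have "wc x *\<^sub>R iexp (s * (x \<bullet> b)) = ?E (s *\<^sub>R b) x + ?E (s *\<^sub>R b + t) x / 2 + ?E (s *\<^sub>R b - t) x / 2" for x
      by (simp add: wc_def complex_eq_iff Re_exp Im_exp inner_add_left inner_diff_left cos_add cos_diff
          sin_add sin_diff inner_commute[of x] field_simps)
    then show ?thesis
      using integrable_iexp_inner[OF M, of "s *\<^sub>R b"] integrable_iexp_inner[OF M, of "s *\<^sub>R b + t"]
        integrable_iexp_inner[OF M, of "s *\<^sub>R b - t"] by simp
  qed
  have 2: "(LINT x|M. wc x * indicator B (x \<bullet> b)) = (LINT x|N. wc x * indicator B (x \<bullet> b) :: real)"
    by (intro weighted_marginal_eqI[OF M N, where C=2]) (simp_all only: C[OF M] C[OF N] cf wc meas B)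
  have S: "(CLINT x|M. ws x *\<^sub>R iexp (s * (x \<bullet> b))) =
      (CLINT x|M. ?E (s *\<^sub>R b) x) - \<i> * (CLINT x|M. ?E (s *\<^sub>R b + t) x) / 2 + \<i> * (CLINT x|M. ?E (s *\<^sub>R b - t) x) / 2"
    if M: "finite_measure M" "sets M = sets borel" for M and s
  proof -
    have "ws x *\<^sub>R iexp (s * (x \<bullet> b)) = ?E (s *\<^sub>R b) x - \<i> * ?E (s *\<^sub>R b + t) x / 2 + \<i> * ?E (s *\<^sub>R b - t) x / 2" for x
      by (simp add: ws_def complex_eq_iff Re_exp Im_exp inner_add_left inner_diff_left cos_add cos_diff
          sin_add sin_diff inner_commute[of x] field_simps)
    then show ?thesis
      using integrable_iexp_inner[OF M, of "s *\<^sub>R b"] integrable_iexp_inner[OF M, of "s *\<^sub>R b + t"]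
        integrable_iexp_inner[OF M, of "s *\<^sub>R b - t"] by simp
  qed
  have 3: "(LINT x|M. ws x * indicator B (x \<bullet> b)) = (LINT x|N. ws x * indicator B (x \<bullet> b) :: real)"
    by (intro weighted_marginal_eqI[OF M N, where C=2]) (simp_all only: S[OF M] S[OF N] cf ws meas B)
  let ?I = "\<lambda>M w. complex_of_real (LINT x|M. w x * indicator B (x \<bullet> b))"
  \<comment> \<open>Subtracting the constant weight 1 recovers the cosine and sine, hence the
    character itself as \<open>(wc - 1) + \<i> * (ws - 1)\<close>.\<close>
  have R: "(CLINT x|M. indicator B (x \<bullet> b) *\<^sub>R iexp (t \<bullet> x)) =
      ?I M wc - ?I M (\<lambda>_. 1) + \<i> * (?I M ws - ?I M (\<lambda>_. 1))"
    if M: "finite_measure M" "sets M = sets borel" for M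
  proof -
    interpret finite_measure M by fact
    note [measurable_cong] = M(2)
    let ?c = "\<lambda>w x. complex_of_real (w x * indicator B (x \<bullet> b))"
    have lin: "(CLINT x|M. f x - g x + \<i> * (h x - g x)) = integral\<^sup>L M f - integral\<^sup>L M g + \<i> * (integral\<^sup>L M h - integral\<^sup>L M g)"
      if "integrable M f" "integrable M g" "integrable M h" for f g h :: "'a \<Rightarrow> complex"
      using that by simp
    have int: "integrable M (?c w)" if "w \<in> borel_measurable borel" "\<And>x. 0 \<le> w x" "\<And>x. w x \<le> 2" for w
    proof -
      note [measurable] = that(1)
      show ?thesis
        using that(2,3) by (intro integrable_const_bound[where B=2]) (auto split: split_indicator)
    qed
    have "indicator B (x \<bullet> b) *\<^sub>R iexp (t \<bullet> x) = ?c wc x - ?c (\<lambda>_. 1) x + \<i> * (?c ws x - ?c (\<lambda>_. 1) x)" for x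
      by (simp add: wc_def ws_def complex_eq_iff Re_exp Im_exp algebra_simps)
    then have "(CLINT x|M. indicator B (x \<bullet> b) *\<^sub>R iexp (t \<bullet> x)) =
        (CLINT x|M. ?c wc x - ?c (\<lambda>_. 1) x + \<i> * (?c ws x - ?c (\<lambda>_. 1) x))"
      by simp
    also have "\<dots> = integral\<^sup>L M (?c wc) - integral\<^sup>L M (?c (\<lambda>_. 1)) + \<i> * (integral\<^sup>L M (?c ws) - integral\<^sup>L M (?c (\<lambda>_. 1)))"
      by (rule lin; rule int) (simp_all only: wc ws meas, simp_all)
    finally show ?thesis unfolding integral_complex_of_real .
  qed
  show ?thesis unfolding R[OF M] R[OF N] 1 2 3 ..
qed

text \<open>Restricting both measures to the same slab in one coordinate preserves equality of their
  full characteristic functions. Doing this for all coordinates in turn and then evaluating at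
  frequency 0 gives equal measures of boxes.\<close>

theorem finite_measure_eqI_cf:
  fixes M N :: "'a::euclidean_space measure"
  assumes M: "finite_measure M" "sets M = sets borel"
    and N: "finite_measure N" "sets N = sets borel"
    and cf: "\<And>t. (CLINT x|M. iexp (t \<bullet> x)) = (CLINT x|N. iexp (t \<bullet> x))"
  shows "M = N"
proof -
  \<comment> \<open>This is \<open>M\<close> restricted to the points whose coordinates in
    \<open>J\<close> lie in the prescribed sets, written as a density so that it stays a measure on
    the whole space.\<close>
  define D where "D = (\<lambda>(M::'a measure) J B. density M (\<lambda>x. \<Prod>b\<in>J. indicator (B b) (x \<bullet> b)))"
  \<comment> \<open>Finiteness is carried through the same induction, and \<open>t\<close> is kept
    arbitrary, because cutting by one more slab needs finite measures and equality at every
    frequency.\<close>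
  have cf_D: "(CLINT x|D M J B. iexp (t \<bullet> x)) = (CLINT x|D N J B. iexp (t \<bullet> x))"
    and D: "finite_measure (D M J B)" "sets (D M J B) = sets borel"
      "finite_measure (D N J B)" "sets (D N J B) = sets borel"
    if "finite J" "\<And>b. B b \<in> sets borel" for J and B :: "'a \<Rightarrow> real set" and t
    using that(1)
  proof (induction J arbitrary: t)
    case empty
    { case 1 then show ?case using cf by (simp add: D_def density_1) }
    { case 2 then show ?case using M by (simp add: D_def density_1) }
    { case 3 then show ?case using M by (simp add: D_def density_1) }
    { case 4 then show ?case using N by (simp add: D_def density_1) }
    { case 5 then show ?case using N by (simp add: D_def density_1) }
  next
    case (insert b J)
    note [measurable] = that(2)
    have step: "D M (insert b J) B = density (D M J B) (\<lambda>x. ennreal (indicator (B b) (x \<bullet> b)))"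
      if "sets M = sets borel" for M
    proof -
      note [measurable_cong] = that(1)
      show ?thesis unfolding D_def
        using insert(1,2) by (subst density_density_eq) (auto simp: mult.commute ennreal_indicator)
    qed
    have fin: "finite_measure (D M (insert b J) B)"
      if "finite_measure (D M J B)" "sets M = sets borel" for M
    proof -
      interpret finite_measure "D M J B" by fact
      have [measurable_cong]: "sets (D M J B) = sets borel" using that by (simp add: D_def)
      have *: "integrable (D M J B) (\<lambda>x. indicator (B b) (x \<bullet> b) :: real)"
        by (intro integrable_const_bound[where B=1]) (auto split: split_indicator)
      then have "(\<integral>\<^sup>+x. ennreal (indicator (B b) (x \<bullet> b)) \<partial>D M J B) < \<infinity>"
        by (subst nn_integral_eq_integral[OF *]) auto
      then show ?thesis unfolding step[OF that(2)]
        by (intro finite_measureI) (auto simp: emeasure_density cong: nn_integral_cong_simp)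
    qed
    have int: "(CLINT x|D M (insert b J) B. iexp (t \<bullet> x)) = (CLINT x|D M J B. indicator (B b) (x \<bullet> b) *\<^sub>R iexp (t \<bullet> x))"
      if "sets M = sets borel" for M t
    proof -
      have [measurable_cong]: "sets (D M J B) = sets borel" using that by (simp add: D_def)
      show ?thesis unfolding step[OF that] by (subst integral_density) auto
    qed
    { case 1 show ?case unfolding int[OF M(2)] int[OF N(2)]
        by (rule cf_indicator_slab) (use insert that in auto) }
    { case 2 show ?case using insert M by (intro fin) }
    { case 3 show ?case using M by (simp add: D_def) }
    { case 4 show ?case using insert N by (intro fin) }
    { case 5 show ?case using N by (simp add: D_def) }
  qed
  have spM: "space M = UNIV" and spN: "space N = UNIV"
    using sets_eq_imp_space_eq[OF M(2)] sets_eq_imp_space_eq[OF N(2)] by auto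
  interpret M: finite_measure M by fact
  interpret N: finite_measure N by fact
  have slabs: "emeasure M {x. \<forall>b\<in>Basis. x \<bullet> b \<in> B b} = emeasure N {x. \<forall>b\<in>Basis. x \<bullet> b \<in> B b}"
    if "\<And>b. B b \<in> sets borel" for B
  proof -
    have em: "measure (D M Basis B) UNIV = measure M {x. \<forall>b\<in>Basis. x \<bullet> b \<in> B b}"
      if "sets M = sets borel" "\<And>b. B b \<in> sets borel" for M
    proof -
      note [measurable_cong] = that(1)
      note [measurable] = that(2)
      have "(\<Prod>b\<in>Basis. indicator (B b) (x \<bullet> b)) = (indicator {x. \<forall>b\<in>Basis. x \<bullet> b \<in> B b} x :: ennreal)" for x
        by (auto simp: indicator_def)
      moreover have "{x. \<forall>b\<in>Basis. x \<bullet> b \<in> B b} \<in> sets borel" by measurable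
      ultimately have "emeasure (D M Basis B) UNIV = emeasure M {x. \<forall>b\<in>Basis. x \<bullet> b \<in> B b}"
        using that by (simp add: D_def emeasure_density del: mem_Collect_eq)
      then show ?thesis by (simp add: measure_def)
    qed
    have D_UNIV: "(CLINT x|D M Basis B. iexp (0 \<bullet> x)) = complex_of_real (measure (D M Basis B) UNIV)"
      if "sets M = sets borel" for M
      using that sets_eq_imp_space_eq[OF that] by (simp add: D_def scaleR_conv_of_real)
    show ?thesis
      \<comment> \<open>Frequency 0 turns the integrals into the masses of the restricted measures,
        that is, the measures of the intersection of the slabs.\<close>
      using cf_D[of Basis B 0] that unfolding D_UNIV[OF M(2)] D_UNIV[OF N(2)]
      by (simp add: em M N M.emeasure_eq_measure N.emeasure_eq_measure)
  qed
  show ?thesis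
  \<comment> \<open>Open boxes are closed under intersection, generate the Borel sets and exhaust
    the space.\<close>
  proof (rule measure_eqI_generator_eq)
    let ?E = "range (\<lambda>(a, b). box a b::'a set)"
    show "Int_stable ?E"
      by (auto simp: Int_stable_def box_Int_box)
    show "?E \<subseteq> Pow UNIV" "sets M = sigma_sets UNIV ?E" "sets N = sigma_sets UNIV ?E"
      by (simp_all add: borel_eq_box M N)
    let ?A = "\<lambda>n::nat. box (- (real n *\<^sub>R One)) (real n *\<^sub>R One) :: 'a set"
    show "range ?A \<subseteq> ?E" "(\<Union>i. ?A i) = UNIV"
      unfolding UN_box_eq_UNIV by auto
    show "emeasure M (?A i) \<noteq> \<infinity>" for i by auto
    show "emeasure M X = emeasure N X" if "X \<in> ?E" for X
    proof -
      from that obtain l u where X: "X = box l u" by auto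
      have "X = {x. \<forall>b\<in>Basis. x \<bullet> b \<in> {l \<bullet> b <..< u \<bullet> b}}"
        by (auto simp: X box_def)
      then show ?thesis using slabs[of "\<lambda>b. {l \<bullet> b <..< u \<bullet> b}"] by simp
    qed
  qed
qed

section \<open>Matrix inverses and linear changes of variables in Lebesgue integrals\<close>

lemma
  fixes A :: "real^'n^'m"
  assumes "invertible A"
  shows invertible_matrix_inv_right: "A ** matrix_inv A = mat 1"
    and invertible_matrix_inv_left: "matrix_inv A ** A = mat 1"
  using someI_ex[OF assms[unfolded invertible_def]] unfolding matrix_inv_def by auto

text \<open>By Fubini, the coordinate along \<open>e\<close> can be integrated first. With the
  others fixed, the shear is a translation in that coordinate by an amount that does not involve it,
  as \<open>a\<close> is orthogonal to \<open>e\<close>.\<close>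

lemma nn_integral_lborel_shear:
  fixes a e :: "'a::euclidean_space"
  assumes e: "e \<in> Basis" and a: "a \<bullet> e = 0" and f[measurable]: "f \<in> borel_measurable borel"
  shows "(\<integral>\<^sup>+x. f (x + (a \<bullet> x) *\<^sub>R e) \<partial>lborel) = (\<integral>\<^sup>+x. f x \<partial>lborel)"
proof -
  interpret product_sigma_finite "\<lambda>_::'a. lborel :: real measure" ..
  define R where "R = Basis - {e}"
  have R: "finite R" "e \<notin> R" and B: "Basis = insert e R"
    using e by (auto simp: R_def)
  let ?z = "\<lambda>y. \<Sum>b\<in>R. y b *\<^sub>R b"
  have fubini: "(\<integral>\<^sup>+x. g x \<partial>lborel) = (\<integral>\<^sup>+y. (\<integral>\<^sup>+s. g (s *\<^sub>R e + ?z y) \<partial>lborel) \<partial>PiM R (\<lambda>_. lborel))"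
    if g[measurable]: "g \<in> borel_measurable borel" for g :: "'a \<Rightarrow> ennreal"
  proof -
    have "(\<integral>\<^sup>+x. g x \<partial>lborel) = (\<integral>\<^sup>+y. g (\<Sum>b\<in>Basis. y b *\<^sub>R b) \<partial>PiM Basis (\<lambda>_. lborel))"
      by (subst lborel_eq) (simp add: nn_integral_distr)
    also have "\<dots> = (\<integral>\<^sup>+y. (\<integral>\<^sup>+s. g (\<Sum>b\<in>insert e R. (y(e := s)) b *\<^sub>R b) \<partial>lborel) \<partial>PiM R (\<lambda>_. lborel))"
      unfolding B by (rule product_nn_integral_insert) (use R in auto)
    moreover have "(\<Sum>b\<in>insert e R. (y(e := s)) b *\<^sub>R b) = s *\<^sub>R e + ?z y" for y s
    proof -
      have "(\<Sum>b\<in>R. (y(e := s)) b *\<^sub>R b) = ?z y"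
        using R(2) by (intro sum.cong) auto
      then show ?thesis using R by simp
    qed
    ultimately show ?thesis by (simp only:)
  qed
  have "(\<integral>\<^sup>+s. f (s *\<^sub>R e + z + (a \<bullet> (s *\<^sub>R e + z)) *\<^sub>R e) \<partial>lborel) = (\<integral>\<^sup>+s. f (s *\<^sub>R e + z) \<partial>lborel)" for z
  proof -
    have "(\<integral>\<^sup>+s. f (s *\<^sub>R e + z) \<partial>lborel) = (\<integral>\<^sup>+s. f ((a \<bullet> z + s) *\<^sub>R e + z) \<partial>lborel)"
      by (subst lborel_distr_plus[symmetric, of "a \<bullet> z"]) (simp add: nn_integral_distr)
    moreover have "(a \<bullet> z + s) *\<^sub>R e + z = s *\<^sub>R e + z + (a \<bullet> (s *\<^sub>R e + z)) *\<^sub>R e" for s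
      by (simp add: a inner_add_right algebra_simps)
    ultimately show ?thesis by (simp only:)
  qed
  then show ?thesis by (simp add: fubini)
qed

lemma prod_Basis_cart: "(\<Prod>b\<in>(Basis :: (real^'n) set). f b) = (\<Prod>i\<in>UNIV. f (axis i 1))"
proof -
  have "(Basis :: (real^'n) set) = range (\<lambda>i. axis i 1)" by (auto simp: Basis_vec_def)
  moreover have "inj (\<lambda>i::'n. axis i (1::real))" by (auto simp: inj_def axis_eq_axis)
  ultimately show ?thesis by (metis (no_types, lifting) prod.reindex_cong)
qed

lemma borel_measurable_matrix_vector_mult [measurable]:
  fixes A :: "real^'n^'m"
  shows "(\<lambda>x. A *v x) \<in> borel_measurable borel"
  by (intro borel_measurable_continuous_onI linear_continuous_on) (simp add: matrix_vector_mul_bounded_linear)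

text \<open>The library's \<open>measure_linear_image\<close> needs a well-ordered index type; decomposing the matrix
  into elementary ones avoids this.\<close>

lemma nn_integral_lborel_linear:
  fixes A :: "real^'n^'n"
  assumes "det A \<noteq> 0" and "f \<in> borel_measurable borel"
  shows "(\<integral>\<^sup>+x. f x \<partial>lborel) = ennreal \<bar>det A\<bar> * (\<integral>\<^sup>+x. f (A *v x) \<partial>lborel)"
  using assms
proof (induction A arbitrary: f rule: induct_matrix_elementary)
  case (1 A B)
  have [measurable]: "f \<in> borel_measurable borel" by fact
  have det: "det A \<noteq> 0" "det B \<noteq> 0" using 1(3) by (auto simp: det_mul)
  have "(\<integral>\<^sup>+x. f x \<partial>lborel) = ennreal \<bar>det A\<bar> * (\<integral>\<^sup>+x. f (A *v x) \<partial>lborel)"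
    by (rule 1(1)[OF det(1)]) simp
  also have "(\<integral>\<^sup>+x. f (A *v x) \<partial>lborel) = ennreal \<bar>det B\<bar> * (\<integral>\<^sup>+x. f (A *v (B *v x)) \<partial>lborel)"
    by (rule 1(2)[OF det(2)]) simp
  finally show ?case
    by (simp add: det_mul abs_mult ennreal_mult matrix_vector_mul_assoc mult.assoc)
next
  case (2 A i)
  \<comment> \<open>A zero row contradicts the nonzero determinant.\<close>
  then show ?case by (simp add: det_zero_row)
next
  case (3 A)
  have [measurable]: "f \<in> borel_measurable borel" by fact
  \<comment> \<open>These are the diagonal entries, indexed by basis vectors rather than coordinates
    to fit \<open>lborel_affine_euclidean\<close>.\<close>
  define c where "c = (\<lambda>b::real^'n. b \<bullet> (A *v b))"
  have c: "c (axis i 1) = A $ i $ i" for i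
    by (simp add: c_def inner_axis' matrix_vector_mul_component inner_axis)
  have det: "det A = (\<Prod>i\<in>UNIV. A $ i $ i)" by (rule det_diagonal) (rule 3)
  have nz: "c b \<noteq> 0" if "b \<in> Basis" for b
    using that 3(2) by (auto simp: Basis_vec_def c det)
  have T: "A *v x = 0 + (\<Sum>b\<in>Basis. (c b * (x \<bullet> b)) *\<^sub>R b)" for x
  proof -
    have "(A *v x) \<bullet> b = c b * (x \<bullet> b)" if b: "b \<in> Basis" for b
    proof -
      obtain i where i: "b = axis i 1" using b by (auto simp: Basis_vec_def)
      have "(A *v x) $ i = (\<Sum>j\<in>UNIV. if j = i then A $ i $ i * x $ i else 0)"
        by (simp only: matrix_vector_mult_def vec_lambda_beta) (intro sum.cong, auto simp: 3(1))
      then show ?thesis by (simp add: i c inner_axis)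
    qed
    then show ?thesis by (subst euclidean_representation[symmetric]) simp
  qed
  have "(\<Prod>b\<in>Basis. \<bar>c b\<bar>) = \<bar>det A\<bar>"
    by (simp add: prod_Basis_cart c det abs_prod)
  with lborel_affine_euclidean[of c 0, OF nz]
  have "lborel = density (distr lborel borel (\<lambda>x. A *v x)) (\<lambda>_. ennreal \<bar>det A\<bar>)"
    by (simp only: T)
  then have "(\<integral>\<^sup>+x. f x \<partial>lborel) = (\<integral>\<^sup>+x. f x \<partial>density (distr lborel borel (\<lambda>x. A *v x)) (\<lambda>_. ennreal \<bar>det A\<bar>))"
    by simp
  then show ?case
    by (simp add: nn_integral_density nn_integral_distr nn_integral_cmult)
next
  case (4 m n)
  have [measurable]: "f \<in> borel_measurable borel" by fact
  let ?t = "Transposition.transpose m n"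
  let ?A = "(\<chi> i j. mat 1 $ i $ ?t j) :: real^'n^'n"
  let ?h = "\<lambda>x::real^'n. \<chi> i. x $ ?t i"
  have A: "?A *v x = ?h x" for x
  proof -
    have "(?A *v x) $ i = (\<Sum>j\<in>UNIV. if j = ?t i then x $ ?t i else 0)" for i
      by (simp only: matrix_vector_mult_def vec_lambda_beta) (intro sum.cong, auto simp: mat_def)
    then show ?thesis by (simp add: vec_eq_iff)
  qed
  have abs_det: "\<bar>det ?A\<bar> = 1"
    by (simp add: det_permute_columns permutes_swap_id sign_swap_id abs_mult)
  have [measurable]: "?h \<in> borel_measurable borel"
    using borel_measurable_matrix_vector_mult[of ?A] by (simp only: A)
  \<comment> \<open>Swapping two coordinates maps a box to the box with swapped corners, whose side
    lengths have the same product.\<close>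
  have "lborel = distr lborel borel ?h"
  proof (rule lborel_eqI)
    fix l u :: "real^'n" assume lu: "\<And>b. b \<in> Basis \<Longrightarrow> l \<bullet> b \<le> u \<bullet> b"
    have le: "l $ i \<le> u $ i" for i
      using lu[of "axis i 1"] by (simp add: inner_axis)
    have "?h -` box l u = box (?h l) (?h u)"
      by (auto simp: mem_box_cart) (metis transpose_involutory)+
    then have "emeasure (distr lborel borel ?h) (box l u) = emeasure lborel (box (?h l) (?h u))"
      by (simp add: emeasure_distr)
    also have "\<dots> = ennreal (\<Prod>b\<in>Basis. (?h u - ?h l) \<bullet> b)"
      using le by (intro emeasure_lborel_box) (auto simp: Basis_vec_def inner_axis)
    also have "(\<Prod>b\<in>Basis. (?h u - ?h l) \<bullet> b) = (\<Prod>b\<in>Basis. (u - l) \<bullet> b)"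
      unfolding prod_Basis_cart
      by (simp add: inner_axis)
        (rule prod.permute[OF permutes_swap_id, of m UNIV n "\<lambda>i. u $ i - l $ i", unfolded o_def, symmetric], auto)
    finally show "emeasure (distr lborel borel ?h) (box l u) = ennreal (\<Prod>b\<in>Basis. (u - l) \<bullet> b)" .
  qed simp
  then have "(\<integral>\<^sup>+x. f x \<partial>lborel) = (\<integral>\<^sup>+x. f x \<partial>distr lborel borel ?h)" by simp
  then show ?case by (simp add: A abs_det nn_integral_distr)
next
  case (5 m n c)
  let ?A = "(\<chi> i j. if i = m \<and> j = n then c else of_bool (i = j)) :: real^'n^'n"
  \<comment> \<open>A row addition is a shear along \<open>axis m 1\<close>; the orthogonality that
    the shear lemma asks for is \<open>m \<noteq> n\<close>.\<close>
  have A: "?A *v x = x + ((c *\<^sub>R axis n 1) \<bullet> x) *\<^sub>R axis m 1" for x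
  proof -
    have "(?A *v x) $ i = (\<Sum>j\<in>UNIV. (if j = i then x $ i else 0) + (if j = n then of_bool (i = m) * c * x $ n else 0))" for i
      using 5(1) by (simp only: matrix_vector_mult_def vec_lambda_beta) (intro sum.cong, auto)
    then show ?thesis
      by (simp add: vec_eq_iff sum.distrib inner_axis') (simp add: axis_def)
  qed
  have "?A = (\<chi> k. if k = m then row m (mat 1) + c *s row n (mat 1) else row k (mat 1))"
    using 5(1) by (auto simp: vec_eq_iff row_def mat_def)
  then have "det ?A = 1"
    using det_row_operation[OF 5(1), of "mat 1" c] by simp
  moreover have "(\<integral>\<^sup>+x. f (?A *v x) \<partial>lborel) = (\<integral>\<^sup>+x. f x \<partial>lborel)"
    unfolding A using 5(1,3) by (intro nn_integral_lborel_shear) (auto simp: inner_axis_axis)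
  ultimately show ?case by simp
qed

lemma nn_integral_lborel_affine:
  fixes A :: "real^'n^'n"
  assumes "det A \<noteq> 0" and f[measurable]: "f \<in> borel_measurable borel"
  shows "(\<integral>\<^sup>+x. f x \<partial>lborel) = (\<integral>\<^sup>+x. ennreal \<bar>det A\<bar> * f (m + A *v x) \<partial>lborel)"
proof -
  have "(\<integral>\<^sup>+x. f x \<partial>lborel) = (\<integral>\<^sup>+x. f (m + x) \<partial>lborel)"
    by (subst lborel_distr_plus[symmetric, of m]) (simp add: nn_integral_distr)
  also have "\<dots> = ennreal \<bar>det A\<bar> * (\<integral>\<^sup>+x. f (m + A *v x) \<partial>lborel)"
    by (rule nn_integral_lborel_linear[OF assms(1)]) simp
  finally show ?thesis by (simp add: nn_integral_cmult)
qed

section \<open>Factorization of positive definite matrices\<close>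

text \<open>Gram-Schmidt for the inner product defined by \<open>S\<close>.\<close>

lemma pos_def_orthonormal_system:
  fixes S :: "real^'n^'n"
  assumes S: "pos_def S" and "k \<le> CARD('n)"
  shows "\<exists>U. finite U \<and> card U = k \<and> (\<forall>x\<in>U. \<forall>y\<in>U. x \<bullet> (S *v y) = (if x = y then 1 else 0))"
  using assms(2)
proof (induction k)
  case 0
  then show ?case by (intro exI[of _ "{}"]) simp
next
  case (Suc k)
  then obtain U where U: "finite U" "card U = k" "\<And>x y. x \<in> U \<Longrightarrow> y \<in> U \<Longrightarrow> x \<bullet> (S *v y) = (if x = y then 1 else 0)"
    by auto
  have sym: "x \<bullet> (S *v y) = y \<bullet> (S *v x)" for x y
    using S by (metis dot_lmul_matrix inner_commute pos_def_def vector_transpose_matrix)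
  \<comment> \<open>The vectors \<open>S *v y\<close> with \<open>y\<close> in \<open>U\<close> span
    a proper subspace, so some nonzero \<open>x\<close> is orthogonal to all of them in the usual
    inner product, hence to \<open>U\<close> in the one given by \<open>S\<close>.\<close>
  have "dim ((\<lambda>y. S *v y) ` U) \<le> card ((\<lambda>y. S *v y) ` U)"
    using U(1) by (intro dim_le_card') auto
  also have "\<dots> \<le> k" using card_image_le[OF U(1)] U(2) by metis
  also have "\<dots> < DIM(real^'n)" using Suc.prems by simp
  finally obtain x where x: "x \<noteq> 0" "\<And>y. y \<in> span ((\<lambda>y. S *v y) ` U) \<Longrightarrow> orthogonal x y"
    using orthogonal_to_subspace_exists by blast
  have pos: "x \<bullet> (S *v x) > 0" using S x(1) by (simp add: pos_def_def)
  define z where "z = (1 / sqrt (x \<bullet> (S *v x))) *\<^sub>R x"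
  have zz: "z \<bullet> (S *v z) = 1"
    using pos by (simp add: z_def matrix_vector_mult_scaleR)
  have zy: "z \<bullet> (S *v y) = 0" if "y \<in> U" for y
    using x(2)[of "S *v y"] that by (simp add: z_def span_base orthogonal_def)
  have "z \<notin> U" using zz zy[of z] by auto
  have yz: "y \<bullet> (S *v z) = 0" if "y \<in> U" for y
    using zy[OF that] sym[of y z] by simp
  then show ?case
    using U zz zy yz \<open>z \<notin> U\<close> by (intro exI[of _ "insert z U"]) auto
qed

text \<open>If the rows of \<open>B\<close> form an orthonormal basis for the inner product given by
  \<open>S\<close>, then \<open>B ** S ** transpose B\<close> is the identity, and the inverse of
  \<open>B\<close> is the required factor.\<close>

lemma pos_def_factorization:
  fixes S :: "real^'n^'n"
  assumes S: "pos_def S"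
  obtains A where "det A \<noteq> 0" "S = A ** transpose A"
proof -
  obtain U where U: "finite U" "card U = CARD('n)" "\<And>x y. x \<in> U \<Longrightarrow> y \<in> U \<Longrightarrow> x \<bullet> (S *v y) = (if x = y then 1 else 0)"
    using pos_def_orthonormal_system[OF S order_refl] by auto
  obtain f :: "'n \<Rightarrow> real^'n" where f: "bij_betw f UNIV U"
    using finite_same_card_bij[of "UNIV :: 'n set" U] U by auto
  define B where "B = (\<chi> i. f i)"
  have "(B ** S ** transpose B) $ i $ j = mat 1 $ i $ j" for i j
  proof -
    have "(B ** S ** transpose B) $ i $ j = f i \<bullet> (S *v f j)"
      unfolding B_def matrix_mul_assoc[symmetric]
      by (simp add: matrix_matrix_mult_def matrix_vector_mult_def inner_vec_def transpose_def)
    also have "\<dots> = mat 1 $ i $ j"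
      using f U(3) by (auto simp: mat_def bij_betw_def inj_on_def)
    finally show ?thesis .
  qed
  then have BSB: "B ** S ** transpose B = mat 1" by (simp add: vec_eq_iff)
  have "det B \<noteq> 0" using arg_cong[OF BSB, of det] by (auto simp: det_mul)
  then have inv: "invertible B" by (simp add: invertible_det_nz)
  define A where "A = matrix_inv B"
  have AB: "A ** B = mat 1" "B ** A = mat 1"
    using inv by (simp_all add: A_def invertible_matrix_inv_left invertible_matrix_inv_right)
  have BA': "transpose B ** transpose A = mat 1"
    using AB by (metis matrix_transpose_mul transpose_mat)
  have "S = (A ** B) ** S ** (transpose B ** transpose A)"
    by (simp add: AB BA')
  also have "\<dots> = A ** (B ** S ** transpose B) ** transpose A"
    by (simp only: matrix_mul_assoc)
  finally have "S = A ** transpose A" by (simp add: BSB)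
  moreover have "det A \<noteq> 0"
    using arg_cong[OF AB(1), of det] by (auto simp: det_mul)
  ultimately show ?thesis using that by blast
qed

section \<open>Gaussian laws, their densities and their affine images\<close>

definition std_gaussian :: "(real^'n) measure" where
  "std_gaussian = density lborel (\<lambda>x. \<Prod>b\<in>Basis. std_normal_density (x \<bullet> b))"

lemma prod_std_normal_density:
  fixes x :: "real^'n"
  shows "(\<Prod>b\<in>Basis. std_normal_density (x \<bullet> b)) = exp (- (x \<bullet> x) / 2) / sqrt ((2 * pi) ^ CARD('n))"
proof -
  have "(\<Prod>b\<in>Basis. std_normal_density (x \<bullet> b)) = (\<Prod>b\<in>Basis. exp (- (x \<bullet> b)\<^sup>2 / 2)) / sqrt (2 * pi) ^ CARD('n)"
    by (simp add: normal_density_def prod.distrib prod_dividef)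
  also have "(\<Prod>b\<in>Basis. exp (- (x \<bullet> b)\<^sup>2 / 2)) = exp (- (x \<bullet> x) / 2)"
    by (simp add: exp_sum[symmetric] euclidean_inner[of x x] power2_eq_square sum_negf sum_divide_distrib)
  finally show ?thesis by (simp only: real_sqrt_power)
qed

text \<open>Density and character are both products over the coordinates, so the total mass and the
  characteristic function factor into the known one-dimensional ones.\<close>

lemma is_mvn_std_gaussian: "is_mvn (std_gaussian :: (real^'n) measure) 0 (mat 1)"
  unfolding is_mvn_def
proof (intro conjI allI)
  show "sets (std_gaussian :: (real^'n) measure) = sets borel" by (simp add: std_gaussian_def)
  have "(\<integral>\<^sup>+x. ennreal (\<Prod>b\<in>Basis. std_normal_density (x \<bullet> b)) \<partial>(lborel :: (real^'n) measure)) =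
      (\<integral>\<^sup>+x. (\<Prod>b\<in>Basis. ennreal (std_normal_density (x \<bullet> b))) \<partial>(lborel :: (real^'n) measure))"
    by (simp add: prod_ennreal)
  also have "\<dots> = (\<Prod>b\<in>(Basis :: (real^'n) set). \<integral>\<^sup>+x. ennreal (std_normal_density x) \<partial>lborel)"
    by (rule nn_integral_lborel_prod) auto
  also have "(\<integral>\<^sup>+x. ennreal (std_normal_density x) \<partial>lborel) = 1"
    using prob_space.emeasure_space_1[OF prob_space_normal_density[of 1 0]]
    by (simp add: emeasure_density)
  finally show "prob_space (std_gaussian :: (real^'n) measure)"
    by (intro prob_spaceI) (simp add: std_gaussian_def emeasure_density)
  fix t :: "real^'n"
  let ?f = "\<lambda>b y. std_normal_density y *\<^sub>R iexp ((t \<bullet> b) * y)"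
  interpret product_sigma_finite "\<lambda>_::real^'n. lborel :: real measure" ..
  have prod: "(\<Prod>b\<in>Basis. std_normal_density (x \<bullet> b)) *\<^sub>R iexp (t \<bullet> x) = (\<Prod>b\<in>Basis. ?f b (x \<bullet> b))" for x
    by (simp add: scaleR_conv_of_real prod.distrib exp_sum[symmetric] euclidean_inner[of t x] sum_distrib_left)
  \<comment> \<open>The character has modulus 1, so the normal density dominates.\<close>
  have int: "integrable lborel (?f b)" for b
    using integrable_normal_density[of 1 0]
    by (rule Bochner_Integration.integrable_bound) auto
  have one: "integral\<^sup>L lborel (?f b) = complex_of_real (exp (- ((t \<bullet> b)\<^sup>2) / 2))" for b
    using fun_cong[OF char_std_normal_distribution, of "t \<bullet> b"]
    by (simp add: char_def integral_density)
  have "(CLINT x|std_gaussian. iexp (t \<bullet> x)) = (CLINT x|lborel. (\<Prod>b\<in>Basis. ?f b (x \<bullet> b)))"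
    unfolding std_gaussian_def
    by (subst integral_density) (auto simp: prod intro!: prod_nonneg)
  also have "\<dots> = (CLINT x|(\<Pi>\<^sub>M b\<in>(Basis::(real^'n) set). lborel). (\<Prod>b\<in>Basis. ?f b (x b)))"
    by (subst lborel_eq, subst integral_distr) (simp_all cong: prod.cong)
  also have "\<dots> = (\<Prod>b\<in>Basis. integral\<^sup>L lborel (?f b))"
    by (rule product_integral_prod[OF finite_Basis int])
  also have "\<dots> = complex_of_real (\<Prod>b\<in>Basis. exp (- ((t \<bullet> b)\<^sup>2) / 2))"
    unfolding one by simp
  also have "(\<Prod>b\<in>Basis. exp (- ((t \<bullet> b)\<^sup>2) / 2)) = exp (- (t \<bullet> t) / 2)"
    by (simp add: exp_sum[symmetric] euclidean_inner[of t t] power2_eq_square sum_negf sum_divide_distrib)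
  also have "complex_of_real \<dots> = exp (\<i> * complex_of_real (t \<bullet> 0) - complex_of_real (t \<bullet> (mat 1 *v t)) / 2)"
    by (simp flip: exp_of_real)
  finally show "(CLINT x|std_gaussian. iexp (t \<bullet> x)) = exp (\<i> * complex_of_real (t \<bullet> 0) - complex_of_real (t \<bullet> (mat 1 *v t)) / 2)" .
qed

text \<open>The frequency \<open>t\<close> of the image becomes the frequency
  \<open>transpose L *v t\<close> of \<open>M\<close>, and the shift contributes a constant phase.
  No density enters, so singular image covariances are covered.\<close>

lemma is_mvn_affine:
  fixes L :: "real^'n^'m"
  assumes "is_mvn M \<mu> S"
  shows "is_mvn (distr M borel (\<lambda>x. c + L *v x)) (c + L *v \<mu>) (L ** S ** transpose L)"
  unfolding is_mvn_def
proof (intro conjI allI)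
  have [measurable_cong]: "sets M = sets borel" using assms by (simp add: is_mvn_def)
  interpret prob_space M using assms by (simp add: is_mvn_def)
  show "prob_space (distr M borel (\<lambda>x. c + L *v x))" by (rule prob_space_distr) simp
  show "sets (distr M borel (\<lambda>x. c + L *v x)) = sets borel" by simp
  fix t :: "real^'m"
  have adj: "t \<bullet> (L *v x) = (transpose L *v t) \<bullet> x" for x
    by (simp add: dot_lmul_matrix)
  have "(CLINT x|distr M borel (\<lambda>x. c + L *v x). iexp (t \<bullet> x)) =
      (CLINT x|M. iexp (t \<bullet> c) * iexp ((transpose L *v t) \<bullet> x))"
    by (simp add: integral_distr inner_add_right adj distrib_left exp_add)
  also have "\<dots> = iexp (t \<bullet> c) * (CLINT x|M. iexp ((transpose L *v t) \<bullet> x))" by simp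
  also have "\<dots> = exp (\<i> * complex_of_real (t \<bullet> (c + L *v \<mu>)) - complex_of_real (t \<bullet> ((L ** S ** transpose L) *v t)) / 2)"
    using assms by (simp add: is_mvn_def inner_add_right adj flip: matrix_vector_mul_assoc exp_add) (simp add: algebra_simps)
  finally show "(CLINT x|distr M borel (\<lambda>x. c + L *v x). iexp (t \<bullet> x)) =
    exp (\<i> * complex_of_real (t \<bullet> (c + L *v \<mu>)) - complex_of_real (t \<bullet> ((L ** S ** transpose L) *v t)) / 2)" .
qed

text \<open>Uniqueness from characteristic functions resolves the definite description in
  \<open>mvn\<close>: exhibiting one measure with the right characteristic function identifies
  it.\<close>

lemma mvn_eqI:
  assumes "is_mvn M \<mu> S"
  shows "mvn \<mu> S = M"
  unfolding mvn_def
proof (rule the_equality)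
  fix N assume "is_mvn N \<mu> S"
  with assms show "N = M"
    by (intro finite_measure_eqI_cf) (auto simp: is_mvn_def prob_space.finite_measure)
qed fact

lemma borel_measurable_mvn_density [measurable]:
  "(\<lambda>x. mvn_density x \<mu> S) \<in> borel_measurable borel"
  unfolding mvn_density_def by measurable

lemma mvn_density_nonneg:
  assumes "pos_def S"
  shows "mvn_density x \<mu> S \<ge> 0"
proof -
  \<comment> \<open>\<open>sqrt\<close> is negative at negative arguments, so the sign of the
    normalizing constant depends on \<open>det S\<close> being a square.\<close>
  obtain A where "det A \<noteq> 0" "S = A ** transpose A"
    using pos_def_factorization[OF assms] .
  then show ?thesis by (simp add: mvn_density_def det_mul)
qed

text \<open>The substitution \<open>x = \<mu> + A *v z\<close> with
  \<open>S = A ** transpose A\<close> turns the density into the standard one, so the measure is an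
  affine image of \<open>std_gaussian\<close>.\<close>

lemma is_mvn_mvn_density:
  fixes S :: "real^'n^'n"
  assumes S: "pos_def S"
  shows "is_mvn (density lborel (\<lambda>x. mvn_density x \<mu> S)) \<mu> S"
proof -
  obtain A where A: "det A \<noteq> 0" "S = A ** transpose A"
    using pos_def_factorization[OF S] .
  have detS: "det S = (det A)\<^sup>2"
    by (simp add: A(2) det_mul power2_eq_square)
  then have invS: "invertible S" using A(1) by (simp add: invertible_det_nz)
  have "invertible A" using A(1) by (simp add: invertible_det_nz)
  \<comment> \<open>Cancelling \<open>A\<close> in \<open>S *v w = A *v z\<close> leaves
    \<open>transpose A *v w = z\<close>; moving \<open>A\<close> across the inner product then gives
    \<open>z \<bullet> z\<close>.\<close>
  have quad: "(A *v z) \<bullet> (matrix_inv S *v (A *v z)) = z \<bullet> z" for z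
  proof -
    define w where "w = matrix_inv S *v (A *v z)"
    have "S *v w = A *v z"
      using invS by (simp add: w_def matrix_vector_mul_assoc matrix_mul_assoc invertible_matrix_inv_right)
    then have "A *v (transpose A *v w) = A *v z" by (simp only: A(2) matrix_vector_mul_assoc)
    then have "matrix_inv A *v (A *v (transpose A *v w)) = matrix_inv A *v (A *v z)" by simp
    then have "transpose A *v w = z"
      by (simp only: matrix_vector_mul_assoc invertible_matrix_inv_left[OF \<open>invertible A\<close>] matrix_mul_assoc matrix_mul_lid matrix_vector_mul_lid)
    then show ?thesis unfolding w_def[symmetric]
      by (metis dot_lmul_matrix inner_commute vector_transpose_matrix transpose_transpose)
  qed
  \<comment> \<open>The Jacobian cancels \<open>sqrt (det S)\<close>, which equals
    \<open>\<bar>det A\<bar>\<close>.\<close>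
  have dens: "\<bar>det A\<bar> * mvn_density (\<mu> + A *v z) \<mu> S = (\<Prod>b\<in>Basis. std_normal_density (z \<bullet> b))" for z
    using A(1) by (simp add: mvn_density_def quad detS prod_std_normal_density real_sqrt_mult)
  have "density lborel (\<lambda>x. mvn_density x \<mu> S) = distr std_gaussian borel (\<lambda>z. \<mu> + A *v z)"
  proof (rule measure_eqI)
    fix B assume "B \<in> sets (density lborel (\<lambda>x. mvn_density x \<mu> S))"
    then have B[measurable]: "B \<in> sets borel" by simp
    have "emeasure (density lborel (\<lambda>x. mvn_density x \<mu> S)) B =
        (\<integral>\<^sup>+x. ennreal \<bar>det A\<bar> * (ennreal (mvn_density (\<mu> + A *v x) \<mu> S) * indicator B (\<mu> + A *v x)) \<partial>lborel)"
      by (simp add: emeasure_density) (subst nn_integral_lborel_affine[OF A(1), where m=\<mu>], auto)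
    also have "\<dots> = (\<integral>\<^sup>+x. ennreal (\<Prod>b\<in>Basis. std_normal_density (x \<bullet> b)) * indicator B (\<mu> + A *v x) \<partial>lborel)"
      by (simp only: dens[symmetric] ennreal_mult[OF abs_ge_zero mvn_density_nonneg[OF S]] mult.assoc)
    also have "\<dots> = emeasure std_gaussian ((\<lambda>z. \<mu> + A *v z) -` B)"
      using measurable_sets[OF _ B, of "\<lambda>z. \<mu> + A *v z" borel]
      unfolding std_gaussian_def
      by (subst emeasure_density) (auto simp: indicator_def vimage_def intro!: nn_integral_cong)
    finally show "emeasure (density lborel (\<lambda>x. mvn_density x \<mu> S)) B = emeasure (distr std_gaussian borel (\<lambda>z. \<mu> + A *v z)) B"
      by (subst emeasure_distr) (auto simp: std_gaussian_def)
  qed simp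
  moreover have "is_mvn (distr std_gaussian borel (\<lambda>z. \<mu> + A *v z)) \<mu> S"
    using is_mvn_affine[OF is_mvn_std_gaussian, of \<mu> A] by (simp add: A(2))
  ultimately show ?thesis by simp
qed

section \<open>Mixture densities and Bayes' rule for the drawn index\<close>

text \<open>This puts the law of \<open>X\<close> in the form in which its density is the
  denominator of \<open>gmm_posterior\<close>.\<close>

lemma gmm_law_eq_density:
  assumes \<alpha>: "\<And>i. i \<in> {1..K} \<Longrightarrow> \<alpha> i \<ge> 0" and S: "\<And>i. i \<in> {1..K} \<Longrightarrow> pos_def (S i)"
    and P: "prob_space P" and X: "has_gmm_law P X K \<alpha> \<mu> S"
  shows "distr P borel X = density lborel (\<lambda>x. \<Sum>i=1..K. \<alpha> i * mvn_density x (\<mu> i) (S i))"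
proof (rule measure_eqI)
  interpret prob_space P by fact
  have [measurable]: "X \<in> borel_measurable P" using X by (simp add: has_gmm_law_def)
  fix B assume "B \<in> sets (distr P borel X)"
  then have B[measurable]: "B \<in> sets borel" by simp
  have comp: "ennreal (\<alpha> i * measure (mvn (\<mu> i) (S i)) B) =
      (\<integral>\<^sup>+x. ennreal (\<alpha> i * mvn_density x (\<mu> i) (S i)) * indicator B x \<partial>lborel)" if i: "i \<in> {1..K}" for i
  proof -
    have mvn: "is_mvn (density lborel (\<lambda>x. mvn_density x (\<mu> i) (S i))) (\<mu> i) (S i)"
      by (rule is_mvn_mvn_density[OF S[OF i]])
    interpret D: prob_space "density lborel (\<lambda>x. mvn_density x (\<mu> i) (S i))"
      using mvn by (simp add: is_mvn_def)
    have "ennreal (\<alpha> i * measure (mvn (\<mu> i) (S i)) B) =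
        ennreal (\<alpha> i) * (\<integral>\<^sup>+x. ennreal (mvn_density x (\<mu> i) (S i)) * indicator B x \<partial>lborel)"
      using \<alpha>[OF i] by (simp add: mvn_eqI[OF mvn] ennreal_mult D.emeasure_eq_measure[symmetric] emeasure_density)
    also have "\<dots> = (\<integral>\<^sup>+x. ennreal (\<alpha> i * mvn_density x (\<mu> i) (S i)) * indicator B x \<partial>lborel)"
      using \<alpha>[OF i] mvn_density_nonneg[OF S[OF i]]
      by (simp add: ennreal_mult nn_integral_cmult[symmetric] mult.assoc)
    finally show ?thesis .
  qed
  interpret D: prob_space "distr P borel X" by (rule prob_space_distr) simp
  have "emeasure (distr P borel X) B = ennreal (\<Sum>i=1..K. \<alpha> i * measure (mvn (\<mu> i) (S i)) B)"
    using X by (simp only: D.emeasure_eq_measure has_gmm_law_def B)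
  also have "\<dots> = (\<Sum>i=1..K. \<integral>\<^sup>+x. ennreal (\<alpha> i * mvn_density x (\<mu> i) (S i)) * indicator B x \<partial>lborel)"
    using \<alpha> by (subst sum_ennreal[symmetric]) (auto intro!: sum.cong comp)
  also have "\<dots> = (\<integral>\<^sup>+x. (\<Sum>i=1..K. ennreal (\<alpha> i * mvn_density x (\<mu> i) (S i))) * indicator B x \<partial>lborel)"
    by (subst nn_integral_sum[symmetric]) (auto simp: sum_distrib_right)
  also have "\<dots> = (\<integral>\<^sup>+x. ennreal (\<Sum>i=1..K. \<alpha> i * mvn_density x (\<mu> i) (S i)) * indicator B x \<partial>lborel)"
    using \<alpha> mvn_density_nonneg[OF S] by (subst sum_ennreal) auto
  also have "\<dots> = emeasure (density lborel (\<lambda>x. \<Sum>i=1..K. \<alpha> i * mvn_density x (\<mu> i) (S i))) B"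
    by (simp add: emeasure_density)
  finally show "emeasure (distr P borel X) B = emeasure (density lborel (\<lambda>x. \<Sum>i=1..K. \<alpha> i * mvn_density x (\<mu> i) (S i))) B" .
qed simp

text \<open>The joint probability is the integral of the posterior weight over \<open>B\<close>
  against the law of \<open>X\<close>; the mixture density cancels the denominator and leaves one
  weighted component.\<close>

lemma prob_component_and_gmm:
  assumes P: "prob_space P"
    and \<alpha>: "\<And>i. i \<in> {1..K} \<Longrightarrow> \<alpha> i \<ge> 0" and S: "\<And>i. i \<in> {1..K} \<Longrightarrow> pos_def (S i)"
    and X: "has_gmm_law P X K \<alpha> \<mu> S"
    and A[measurable]: "A \<in> sets P" and i: "i \<in> {1..K}"
    and cond: "AE \<omega> in P. cond_prob_given P X A \<omega> = gmm_posterior K \<alpha> \<mu> S i (X \<omega>)"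
    and B[measurable]: "B \<in> sets borel"
  shows "measure P (A \<inter> (X -` B \<inter> space P)) = \<alpha> i * measure (mvn (\<mu> i) (S i)) B"
proof -
  interpret prob_space P by fact
  have [measurable]: "X \<in> borel_measurable P" using X by (simp add: has_gmm_law_def)
  let ?F = "vimage_algebra (space P) X borel"
  let ?g = "\<lambda>x. \<Sum>j=1..K. \<alpha> j * mvn_density x (\<mu> j) (S j)"
  let ?p = "gmm_posterior K \<alpha> \<mu> S i"
  have [measurable]: "?p \<in> borel_measurable borel"
    unfolding gmm_posterior_def by measurable
  have "subalgebra P ?F"
    by (auto simp: subalgebra_def sets_vimage_algebra2)
  then interpret finite_measure_subalgebra P ?F by unfold_locales
  have XB: "X -` B \<inter> space P \<in> sets ?F" by (rule in_vimage_algebra) simp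
  have nn: "0 \<le> \<alpha> j * mvn_density x (\<mu> j) (S j)" if "j \<in> {1..K}" for x j
    using \<alpha>[OF that] mvn_density_nonneg[OF S[OF that]] by simp
  \<comment> \<open>Where the mixture density vanishes, so does each of its nonnegative summands,
    and both sides are 0 whatever the quotient is there.\<close>
  have bayes: "?g x * ?p x = \<alpha> i * mvn_density x (\<mu> i) (S i)" for x
  proof (cases "?g x = 0")
    case True
    then have "\<alpha> i * mvn_density x (\<mu> i) (S i) = 0"
      using i nn by (subst (asm) sum_nonneg_eq_0_iff) auto
    then show ?thesis using True by simp
  qed (simp add: gmm_posterior_def)
  have law: "distr P borel X = density lborel ?g"
    by (rule gmm_law_eq_density[OF _ _ P X]) (rule \<alpha>, assumption, rule S)
  have "measure P (A \<inter> (X -` B \<inter> space P)) = (\<integral>\<omega>\<in>X -` B \<inter> space P. indicator A \<omega> \<partial>P)"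
    by (simp add: set_lebesgue_integral_def flip: indicator_inter_arith)
       (simp add: Int_commute)
  \<comment> \<open>The defining property of conditional expectation applies because the preimage of
    \<open>B\<close> lies in the sigma-algebra generated by \<open>X\<close>.\<close>
  also have "\<dots> = (\<integral>\<omega>\<in>X -` B \<inter> space P. cond_prob_given P X A \<omega> \<partial>P)"
    unfolding cond_prob_given_def by (rule real_cond_exp_intA) (simp_all add: XB integrable_real_indicator less_top[symmetric])
  also have "\<dots> = (\<integral>\<omega>. indicator B (X \<omega>) * ?p (X \<omega>) \<partial>P)"
    unfolding set_lebesgue_integral_def cond_prob_given_def
    using cond unfolding cond_prob_given_def
    by (intro integral_cong_AE) (auto split: split_indicator)
  also have "\<dots> = (\<integral>x. indicator B x * ?p x \<partial>distr P borel X)"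
    by (simp add: integral_distr)
  also have "\<dots> = (\<integral>x. ?g x * (indicator B x * ?p x) \<partial>lborel)"
    unfolding law
  proof (rule integral_real_density)
    show "AE x in lborel. 0 \<le> ?g x" by (intro AE_I2 sum_nonneg nn)
  qed measurable
  also have "\<dots> = (\<integral>x. \<alpha> i * (mvn_density x (\<mu> i) (S i) * indicator B x) \<partial>lborel)"
  proof (intro Bochner_Integration.integral_cong refl)
    fix x
    have "?g x * (indicator B x * ?p x) = (?g x * ?p x) * indicator B x"
      by (rule mult.left_commute[THEN trans]) (rule mult.commute)
    then show "?g x * (indicator B x * ?p x) = \<alpha> i * (mvn_density x (\<mu> i) (S i) * indicator B x)"
      unfolding bayes by (simp only: mult.assoc)
  qed
  also have "\<dots> = \<alpha> i * (\<integral>x. indicator B x \<partial>density lborel (\<lambda>x. mvn_density x (\<mu> i) (S i)))"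
    by (subst integral_real_density) (auto simp: mvn_density_nonneg[OF S[OF i]])
  also have "\<dots> = \<alpha> i * measure (mvn (\<mu> i) (S i)) B"
    by (simp add: mvn_eqI[OF is_mvn_mvn_density[OF S[OF i]]])
  finally show ?thesis .
qed

section \<open>The law of the controls under the randomized policy\<close>

theorem proposition4:
  fixes P :: "'w measure"
    and x0 :: "'w \<Rightarrow> real^'nx"
    and \<alpha> :: "nat \<Rightarrow> real"
    and \<mu>0 :: "nat \<Rightarrow> real^'nx"
    and S0 :: "nat \<Rightarrow> real^'nx^'nx"
    and K N :: nat
    and v :: "nat \<Rightarrow> real^'nu"
    and L :: "nat \<Rightarrow> nat \<Rightarrow> real^'nx^'nu"
    and \<mu>g :: "real^'nx"
    and I :: "'w \<Rightarrow> nat"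
    and u :: "nat \<Rightarrow> 'w \<Rightarrow> real^'nu"
  assumes "prob_space P"
    and "\<And>i. i \<in> {1..K} \<Longrightarrow> \<alpha> i \<ge> 0"
    and "(\<Sum>i=1..K. \<alpha> i) = 1"
    and "\<And>i. i \<in> {1..K} \<Longrightarrow> pos_def (S0 i)"
    and "has_gmm_law P x0 K \<alpha> \<mu>0 S0"
    and "\<mu>g = prob_space.expectation P x0"
    and "I \<in> measurable P (count_space {1..K})"
    and "\<And>i. i \<in> {1..K} \<Longrightarrow>
           AE \<omega> in P. cond_prob_given P x0 {\<omega> \<in> space P. I \<omega> = i} \<omega> = gmm_posterior K \<alpha> \<mu>0 S0 i (x0 \<omega>)"
    and "\<And>k \<omega>. k < N \<Longrightarrow> \<omega> \<in> space P \<Longrightarrow> u k \<omega> = v k + L k (I \<omega>) *v (x0 \<omega> - \<mu>g)"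
  shows "\<forall>k<N. has_gmm_law P (u k) K \<alpha>
           (\<lambda>i. v k + L k i *v (\<mu>0 i - \<mu>g))
           (\<lambda>i. L k i ** S0 i ** transpose (L k i))"
proof (intro allI impI)
  fix k assume k: "k < N"
  interpret prob_space P by fact
  note \<alpha> = assms(2) and S = assms(4) and X = assms(5) and I = assms(7)
  have [measurable]: "x0 \<in> borel_measurable P" using X by (simp add: has_gmm_law_def)
  note [measurable] = I
  let ?T = "\<lambda>i x. v k + L k i *v (x - \<mu>g)"
  \<comment> \<open>Collecting the constant terms gives the shape that \<open>is_mvn_affine\<close>
    expects.\<close>
  have T: "?T i x = (v k - L k i *v \<mu>g) + L k i *v x" for i x
    by (simp add: matrix_vector_mult_diff_distrib)
  have [measurable]: "?T i \<in> borel_measurable borel" for i by measurable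
  have IK: "I \<omega> \<in> {1..K}" if "\<omega> \<in> space P" for \<omega>
    using measurable_space[OF I that] by simp
  \<comment> \<open>The index ranges over a finite set, so measurability follows from that of each
    branch.\<close>
  have "(\<lambda>\<omega>. ?T (I \<omega>) (x0 \<omega>)) \<in> borel_measurable P"
    by (rule measurable_compose_countable'[OF _ I]) auto
  also have "?this \<longleftrightarrow> u k \<in> borel_measurable P"
    using assms(9)[OF k] by (intro measurable_cong) simp
  finally have u[measurable]: "u k \<in> borel_measurable P" .
  let ?A = "\<lambda>i. {\<omega> \<in> space P. I \<omega> = i}"
  have A: "?A i \<in> sets P" if "i \<in> {1..K}" for i
    using measurable_sets[OF I, of "{i}"] that by (simp add: vimage_def Int_def conj_commute)
  have "measure (distr P borel (u k)) B =
      (\<Sum>i=1..K. \<alpha> i * measure (mvn (?T i (\<mu>0 i)) (L k i ** S0 i ** transpose (L k i))) B)"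
    if B[measurable]: "B \<in> sets borel" for B
  proof -
    let ?E = "\<lambda>i. ?A i \<inter> (x0 -` (?T i -` B) \<inter> space P)"
    have TB: "?T i -` B \<in> sets borel" for i
      using measurable_sets[of "?T i" borel borel B] by simp
    \<comment> \<open>The event is split by the drawn index; where it equals \<open>i\<close>, the
      control lies in \<open>B\<close> exactly if the state lies in the preimage of \<open>B\<close>
      under \<open>?T i\<close>.\<close>
    have "u k -` B \<inter> space P = (\<Union>i\<in>{1..K}. ?E i)"
      using IK assms(9)[OF k] by auto
    then have "measure (distr P borel (u k)) B = measure P (\<Union>i\<in>{1..K}. ?E i)"
      by (simp add: measure_distr)
    also have "\<dots> = (\<Sum>i=1..K. measure P (?E i))"
    proof (rule finite_measure_finite_Union)
      show "?E ` {1..K} \<subseteq> sets P"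
        using A TB by (intro image_subsetI sets.Int measurable_sets[of x0 P borel]) simp_all
      show "disjoint_family_on ?E {1..K}" by (auto simp: disjoint_family_on_def)
    qed simp
    also have "\<dots> = (\<Sum>i=1..K. \<alpha> i * measure (mvn (\<mu>0 i) (S0 i)) (?T i -` B))"
      by (intro sum.cong refl prob_component_and_gmm[OF assms(1) \<alpha> S X A _ assms(8) TB])
    also have "\<dots> = (\<Sum>i=1..K. \<alpha> i * measure (mvn (?T i (\<mu>0 i)) (L k i ** S0 i ** transpose (L k i))) B)"
    proof (intro sum.cong refl)
      fix i assume i: "i \<in> {1..K}"
      \<comment> \<open>The density supplies existence of the component law, so \<open>mvn\<close>
        denotes a genuine Gaussian law here.\<close>
      have mvn: "is_mvn (mvn (\<mu>0 i) (S0 i)) (\<mu>0 i) (S0 i)"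
        using is_mvn_mvn_density[OF S[OF i], of "\<mu>0 i"] mvn_eqI by metis
      then have [measurable_cong]: "sets (mvn (\<mu>0 i) (S0 i)) = sets borel" by (simp add: is_mvn_def)
      then have [simp]: "space (mvn (\<mu>0 i) (S0 i)) = UNIV"
        using sets_eq_imp_space_eq by fastforce
      have "mvn (?T i (\<mu>0 i)) (L k i ** S0 i ** transpose (L k i)) = distr (mvn (\<mu>0 i) (S0 i)) borel (?T i)"
        unfolding T by (rule mvn_eqI[OF is_mvn_affine[OF mvn]])
      then show "\<alpha> i * measure (mvn (\<mu>0 i) (S0 i)) (?T i -` B) =
          \<alpha> i * measure (mvn (?T i (\<mu>0 i)) (L k i ** S0 i ** transpose (L k i))) B"
        by (simp add: measure_distr)
    qed
    finally show ?thesis .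
  qed
  then show "has_gmm_law P (u k) K \<alpha> (\<lambda>i. ?T i (\<mu>0 i)) (\<lambda>i. L k i ** S0 i ** transpose (L k i))"
    using u by (simp add: has_gmm_law_def)
qed

end
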